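(* Let $n$ be a positive integer. Then the unitary Cayley graph $X_n$ admits fractional revival if and only if it admits pretty good fractional revival.
   Context: The unitary Cayley graph $X_n$ is the simple undirected graph with vertex set $\mathbb{Z}_n$ in which two distinct vertices $a,b$ are adjacent if and only if $a-b\equiv u \pmod n$ for some integer $u$ with $1\le u\le n-1$ and $\gcd(u,n)=1$. For a finite simple undirected graph $\Gamma$ with adjacency matrix $A$, the transition matrix is $H(t)=\exp(-\mathbf{i}tA)$, $t\in\mathbb{R}$, where $\mathbf{i}=\sqrt{-1}$. For a vertex $a$, $\mathbf{e}_a$ is the standard basis column vector indexed by the vertices with entry $1$ at $a$ and $0$ elsewhere. $\Gamma$ admits fractional revival (FR) from a vertex $a$ to another vertex $b\ne a$ if there is a real number $t>0$ such that $H(t)\mathbf{e}_a=\alpha\mathbf{e}_a+\beta\mathbf{e}_b$ for some complex numbers $\alpha,\beta$ with $\beta\neq 0$ and $|\alpha|^2+|\beta|^2=1$. $\Gamma$ admits pretty good fractional revival (PGFR) from $a$ to $b\neq a$ if there is a real sequence $\{t_k\}$ such that $\lim_{k\to\infty}H(t_k)\mathbf{e}_a=\alpha\mathbf{e}_a+\beta\mathbf{e}_b$ for some complex numbers $\alpha,\beta$ with $\beta\neq 0$ and $|\alpha|^2+|\beta|^2=1$. $\Gamma$ admits FR (respectively PGFR) if it does so from some vertex $a$ to some other vertex $b$. *)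

theory Defs
  imports Complex_Main "HOL-Number_Theory.Cong" "Jordan_Normal_Form.Matrix"
begin

text \<open>A finite simple undirected graph of order \<open>n\<close> is given by its adjacency relation \<open>E\<close> on the
  vertex set \<open>{..<n}\<close>, so that its matrices are \<open>n\<close> by \<open>n\<close> with vertices as indices.\<close>

definition simple_graph :: "nat \<Rightarrow> (nat \<Rightarrow> nat \<Rightarrow> bool) \<Rightarrow> bool" where
  "simple_graph n E \<longleftrightarrow>
     (\<forall>a<n. \<not> E a a) \<and> (\<forall>a<n. \<forall>b<n. E a b \<longrightarrow> E b a)"

text \<open>The elements of the ring of integers modulo \<open>n\<close> are represented by the residues
  \<open>0, \<dots>, n - 1\<close>.  The difference of two residues is taken in the integers.\<close>

definition unitary_Cayley_adj :: "nat \<Rightarrow> nat \<Rightarrow> nat \<Rightarrow> bool" where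
  "unitary_Cayley_adj n a b \<longleftrightarrow> a < n \<and> b < n \<and> a \<noteq> b \<and>
     (\<exists>u::int. 1 \<le> u \<and> u \<le> int n - 1 \<and> gcd u (int n) = 1 \<and>
        [int a - int b = u] (mod int n))"

lemma simple_graph_unitary_Cayley: "simple_graph n (unitary_Cayley_adj n)"
proof -
  have "unitary_Cayley_adj n b a" if "unitary_Cayley_adj n a b" for a b
  proof -
    from that obtain u :: int where ab: "a < n" "b < n" "a \<noteq> b"
      and u: "1 \<le> u" "u \<le> int n - 1" "gcd u (int n) = 1" "[int a - int b = u] (mod int n)"
      unfolding unitary_Cayley_adj_def by (elim conjE exE)
    have "gcd (int n - u) (int n) = 1"
    proof -
      have "gcd (int n - u) (int n) = gcd (u - int n) (int n)"
        using gcd_neg1_int[of "u - int n" "int n"] by (simp only: minus_diff_eq)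
      also have "\<dots> = gcd u (int n)" by (rule gcd_diff1)
      finally show ?thesis using u(3) by simp
    qed
    moreover have "[int b - int a = int n - u] (mod int n)"
    proof -
      have "[int n - (int a - int b) = int n - u] (mod int n)"
        using u(4) by (intro cong_diff cong_refl)
      moreover have "[int b - int a = int n - (int a - int b)] (mod int n)"
        unfolding cong_iff_dvd_diff by simp
      ultimately show ?thesis by (rule cong_trans[rotated])
    qed
    ultimately show ?thesis
      using ab u(1,2) unfolding unitary_Cayley_adj_def
      by (intro conjI exI[of _ "int n - u"]) simp_all
  qed
  moreover have "\<not> unitary_Cayley_adj n a a" for a
    by (simp add: unitary_Cayley_adj_def)
  ultimately show ?thesis
    by (simp add: simple_graph_def)
qed

definition adjacency_matrix :: "nat \<Rightarrow> (nat \<Rightarrow> nat \<Rightarrow> bool) \<Rightarrow> complex mat" where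
  "adjacency_matrix n E = mat n n (\<lambda>(a, b). if E a b then 1 else 0)"

text \<open>The exponential of a square matrix is the sum of the usual power series.  The type of
  matrices carries no topology, so the series is summed entrywise; each of the entry series
  converges absolutely.\<close>

definition mat_exp :: "complex mat \<Rightarrow> complex mat" where
  "mat_exp M = mat (dim_row M) (dim_row M)
     (\<lambda>(i, j). \<Sum>k. (M ^\<^sub>m k) $$ (i, j) / fact k)"

lemma mat_exp_entry_summable:
  fixes M :: "complex mat"
  assumes M: "M \<in> carrier_mat n n" and i: "i < n" and j: "j < n"
  shows "summable (\<lambda>k. norm ((M ^\<^sub>m k) $$ (i, j) / fact k))"
proof -
  define C where "C = (\<Sum>p<n. \<Sum>q<n. norm (M $$ (p, q)))"
  have C0: "0 \<le> C" unfolding C_def by (intro sum_nonneg) auto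
  have entry: "norm (M $$ (p, q)) \<le> C" if "p < n" "q < n" for p q
  proof -
    have "norm (M $$ (p, q)) \<le> (\<Sum>q<n. norm (M $$ (p, q)))"
      using that by (intro member_le_sum) auto
    also have "\<dots> \<le> C" unfolding C_def
      using that by (intro member_le_sum[where f = "\<lambda>p. \<Sum>q<n. norm (M $$ (p, q))"] sum_nonneg) auto
    finally show ?thesis .
  qed
  have bound: "\<forall>p<n. \<forall>q<n. norm ((M ^\<^sub>m k) $$ (p, q)) \<le> (real n * C) ^ k" for k
  proof (induction k)
    case 0
    then show ?case using M by auto
  next
    case (Suc k)
    show ?case
    proof (intro allI impI)
      fix p q assume pq: "p < n" "q < n"
      have Mk: "M ^\<^sub>m k \<in> carrier_mat n n" using M by (simp add: pow_carrier_mat)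
      have "(M ^\<^sub>m Suc k) $$ (p, q) = (\<Sum>r\<in>{0..<n}. (M ^\<^sub>m k) $$ (p, r) * M $$ (r, q))"
        using M Mk pq by (simp add: scalar_prod_def)
      then have "norm ((M ^\<^sub>m Suc k) $$ (p, q))
          \<le> (\<Sum>r\<in>{0..<n}. norm ((M ^\<^sub>m k) $$ (p, r)) * norm (M $$ (r, q)))"
        by (simp only: norm_mult[symmetric] norm_sum)
      also have "\<dots> \<le> (\<Sum>r\<in>{0..<n}. (real n * C) ^ k * C)"
        using Suc.IH pq entry C0 by (intro sum_mono mult_mono) auto
      also have "\<dots> = (real n * C) ^ Suc k" by simp
      finally show "norm ((M ^\<^sub>m Suc k) $$ (p, q)) \<le> (real n * C) ^ Suc k" .
    qed
  qed
  have "summable (\<lambda>k. inverse (fact k) * (real n * C) ^ k)"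
    by (rule summable_exp)
  moreover have "norm (norm ((M ^\<^sub>m k) $$ (i, j) / fact k)) \<le> inverse (fact k) * (real n * C) ^ k"
    for k
  proof -
    have "norm ((M ^\<^sub>m k) $$ (i, j)) / fact k \<le> (real n * C) ^ k / fact k"
      using bound[of k] i j by (intro divide_right_mono) auto
    then show ?thesis
      by (simp add: norm_divide) (simp add: divide_inverse mult.commute)
  qed
  ultimately show ?thesis
    by (rule summable_comparison_test'[where N = 0])
qed

definition transition_matrix :: "nat \<Rightarrow> (nat \<Rightarrow> nat \<Rightarrow> bool) \<Rightarrow> real \<Rightarrow> complex mat" where
  "transition_matrix n E t = mat_exp ((- \<i> * complex_of_real t) \<cdot>\<^sub>m adjacency_matrix n E)"

definition FR_from_to :: "nat \<Rightarrow> (nat \<Rightarrow> nat \<Rightarrow> bool) \<Rightarrow> nat \<Rightarrow> nat \<Rightarrow> bool" where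
  "FR_from_to n E a b \<longleftrightarrow> a < n \<and> b < n \<and> a \<noteq> b \<and>
     (\<exists>t>0. \<exists>\<alpha> \<beta>. \<beta> \<noteq> 0 \<and> (cmod \<alpha>)\<^sup>2 + (cmod \<beta>)\<^sup>2 = 1 \<and>
        transition_matrix n E t *\<^sub>v unit_vec n a
          = \<alpha> \<cdot>\<^sub>v unit_vec n a + \<beta> \<cdot>\<^sub>v unit_vec n b)"

definition admits_FR :: "nat \<Rightarrow> (nat \<Rightarrow> nat \<Rightarrow> bool) \<Rightarrow> bool" where
  "admits_FR n E \<longleftrightarrow> (\<exists>a b. FR_from_to n E a b)"

text \<open>Convergence of a sequence of complex vectors of dimension \<open>n\<close> is componentwise.\<close>

definition vec_tendsto :: "nat \<Rightarrow> (nat \<Rightarrow> complex vec) \<Rightarrow> complex vec \<Rightarrow> bool" where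
  "vec_tendsto n v w \<longleftrightarrow> (\<forall>i<n. (\<lambda>k. v k $ i) \<longlonglongrightarrow> w $ i)"

definition PGFR_from_to :: "nat \<Rightarrow> (nat \<Rightarrow> nat \<Rightarrow> bool) \<Rightarrow> nat \<Rightarrow> nat \<Rightarrow> bool" where
  "PGFR_from_to n E a b \<longleftrightarrow> a < n \<and> b < n \<and> a \<noteq> b \<and>
     (\<exists>t :: nat \<Rightarrow> real. \<exists>\<alpha> \<beta>. \<beta> \<noteq> 0 \<and> (cmod \<alpha>)\<^sup>2 + (cmod \<beta>)\<^sup>2 = 1 \<and>
        vec_tendsto n (\<lambda>k. transition_matrix n E (t k) *\<^sub>v unit_vec n a)
          (\<alpha> \<cdot>\<^sub>v unit_vec n a + \<beta> \<cdot>\<^sub>v unit_vec n b))"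

definition admits_PGFR :: "nat \<Rightarrow> (nat \<Rightarrow> nat \<Rightarrow> bool) \<Rightarrow> bool" where
  "admits_PGFR n E \<longleftrightarrow> (\<exists>a b. PGFR_from_to n E a b)"

end

theory Submission
  imports Defs "HOL-Analysis.Elementary_Topology"
begin

text \<open>The graph is circulant, hence diagonalised by the additive characters modulo \<open>n\<close>, and its
  eigenvalues are Ramanujan sums, which are integers.  So the transition matrix is continuous and
  \<open>2\<pi>\<close>-periodic in time, and any sequence of times may be replaced by one in the compact interval
  \<open>[2\<pi>, 4\<pi>]\<close>.  At a limit point of that sequence, the limit is attained exactly.\<close>

section \<open>Additive characters and Ramanujan sums\<close>

text \<open>The additive character x -> exp(2 pi i x / n), taken on all integers so that differences
  of vertices need no reduction modulo \<open>n\<close>.\<close>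

definition rou :: "nat \<Rightarrow> int \<Rightarrow> complex" where
  "rou n x = cis (2 * pi * (of_int x / of_nat n))"

lemma rou_add: "rou n (x + y) = rou n x * rou n y"
  by (simp add: rou_def cis_mult add_divide_distrib distrib_left)

lemma rou_0 [simp]: "rou n 0 = 1"
  by (simp add: rou_def)

lemma rou_mult_nat: "rou n (int k * x) = rou n x ^ k"
  by (induction k) (simp_all add: rou_add distrib_right)

lemma rou_dvd:
  assumes "n > 0" "int n dvd x"
  shows "rou n x = 1"
proof -
  obtain k where k: "x = int n * k" using assms(2) by (elim dvdE)
  have "cis (2 * pi * of_int k) = 1" by (rule cis_multiple_2pi) simp
  then show ?thesis using assms(1) by (simp add: rou_def k)
qed

lemma rou_eq_1D:
  assumes "n > 0" "rou n x = 1"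
  shows "int n dvd x"
proof -
  have "cos (2 * pi * (of_int x / of_nat n)) = 1"
    using assms(2) by (simp add: rou_def complex_eq_iff)
  then obtain k :: int where "2 * pi * (of_int x / of_nat n) = of_int k * 2 * pi"
    by (auto simp: cos_one_2pi_int)
  then have "real_of_int x = of_int (int n * k)"
    using assms(1) by (simp add: field_simps)
  then show ?thesis by (simp only: of_int_eq_iff) simp
qed

lemma rou_cong:
  assumes "n > 0" "[x = y] (mod int n)"
  shows "rou n x = rou n y"
proof -
  have "rou n (x - y) = 1"
    using assms by (intro rou_dvd) (simp_all add: cong_iff_dvd_diff)
  then show ?thesis using rou_add[of n "x - y" y] by simp
qed

text \<open>Orthogonality of characters: unless \<open>n\<close> divides \<open>x\<close>, this is a
  geometric sum whose ratio is an \<open>n\<close>-th root of unity other than 1.\<close>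

lemma sum_rou:
  assumes "n > 0"
  shows "(\<Sum>k<n. rou n (int k * x)) = (if int n dvd x then of_nat n else 0)"
proof (cases "int n dvd x")
  case True
  then show ?thesis using assms by (simp add: rou_mult_nat rou_dvd)
next
  case False
  then have "rou n x \<noteq> 1" using rou_eq_1D[OF assms] by blast
  moreover have "rou n x ^ n = 1"
    using assms by (simp flip: rou_mult_nat add: rou_dvd)
  ultimately show ?thesis using False by (simp add: rou_mult_nat geometric_sum)
qed

text \<open>With n = g m, the summation index is g y for y < m, and the character modulo
  \<open>n\<close> at g y is the one modulo \<open>m\<close> at y. What results is a full character
  sum modulo \<open>m\<close>, equal to \<open>m\<close> or 0.\<close>

lemma sum_rou_multiples_Ints:
  assumes "n > 0" "g dvd n"
  shows "(\<Sum>x | x < n \<and> g dvd x. rou n (int x * j)) \<in> \<int>"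
proof -
  obtain m where m: "n = g * m" using assms(2) by (elim dvdE)
  have pos: "g > 0" "m > 0" using assms(1) m by auto
  have "(\<Sum>x | x < n \<and> g dvd x. rou n (int x * j)) = (\<Sum>y<m. rou m (int y * j))"
    using pos
    by (intro sum.reindex_bij_witness[where i = "\<lambda>y. g * y" and j = "\<lambda>x. x div g"])
       (auto simp: m rou_def mult.assoc elim!: dvdE)
  then show ?thesis using sum_rou[OF pos(2), of j] by simp
qed

text \<open>Descending induction on the divisor \<open>g\<close>, in place of Moebius inversion: the
  integral sum over all multiples of \<open>g\<close> splits by the exact gcd \<open>h\<close> with
  \<open>n\<close>, and every class with h \<noteq> g has h > g. The case g = 1 is the Ramanujan
  sum.\<close>

lemma sum_rou_gcd_Ints:
  assumes "n > 0" "g dvd n"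
  shows "(\<Sum>x | x < n \<and> gcd x n = g. rou n (int x * j)) \<in> \<int>"
  using assms(2)
proof (induction "n - g" arbitrary: g rule: less_induct)
  case less
  define S where "S h = (\<Sum>x | x < n \<and> gcd x n = h. rou n (int x * j))" for h
  define T where "T = {h. g dvd h \<and> h dvd n}"
  have fin: "finite T" unfolding T_def using assms(1) by simp
  have "(\<Sum>x | x < n \<and> g dvd x. rou n (int x * j))
      = (\<Sum>h\<in>T. \<Sum>x\<in>{x \<in> {x. x < n \<and> g dvd x}. gcd x n = h}. rou n (int x * j))"
    using fin less.prems by (intro sum.group[symmetric]) (auto simp: T_def)
  also have "\<dots> = (\<Sum>h\<in>T. S h)"
    unfolding S_def T_def by (intro sum.cong refl) auto
  also have "\<dots> = S g + (\<Sum>h\<in>T - {g}. S h)"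
    using fin less.prems by (intro sum.remove) (auto simp: T_def)
  finally have "S g = (\<Sum>x | x < n \<and> g dvd x. rou n (int x * j)) - (\<Sum>h\<in>T - {g}. S h)"
    by simp
  moreover have "S h \<in> \<int>" if "h \<in> T - {g}" for h
  proof -
    have h: "g dvd h" "h dvd n" "h \<noteq> g" using that by (auto simp: T_def)
    then have "g < h" "h \<le> n"
      using assms(1) by (auto intro!: dvd_imp_le le_neq_trans dest: dvd_pos_nat)
    then show ?thesis unfolding S_def using h by (intro less.hyps) auto
  qed
  ultimately show ?case
    using sum_rou_multiples_Ints[OF assms(1) less.prems, of j]
    unfolding S_def[symmetric] by (auto intro!: Ints_diff Ints_sum)
qed

definition ramanujan_sum :: "nat \<Rightarrow> int \<Rightarrow> complex" where
  "ramanujan_sum n j = (\<Sum>x | x < n \<and> coprime x n. rou n (int x * j))"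

lemma ramanujan_sum_Ints: "n > 0 \<Longrightarrow> ramanujan_sum n j \<in> \<int>"
  using sum_rou_gcd_Ints[of n 1 j] by (simp add: ramanujan_sum_def coprime_iff_gcd_eq_1)

section \<open>Spectral decomposition of the transition matrix\<close>

text \<open>Translation by \<open>c\<close> permutes the residues modulo \<open>n\<close>.\<close>

lemma sum_periodic_shift:
  fixes f :: "int \<Rightarrow> 'a::comm_monoid_add"
  assumes "n > 0" and per: "\<And>x. f (x mod int n) = f x"
  shows "(\<Sum>r<n. f (int r - c)) = (\<Sum>r<n. f (int r))"
proof (rule sum.reindex_bij_witness
    [where i = "\<lambda>x. nat ((int x + c) mod int n)" and j = "\<lambda>r. nat ((int r - c) mod int n)"])
  fix r assume "r \<in> {..<n}"
  then show "nat ((int (nat ((int r - c) mod int n)) + c) mod int n) = r"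
    "nat ((int (nat ((int r + c) mod int n)) - c) mod int n) = r"
    using assms(1) by (simp_all add: mod_simps)
  show "nat ((int r - c) mod int n) \<in> {..<n}" "nat ((int r + c) mod int n) \<in> {..<n}"
    using assms(1) by (simp_all add: nat_less_iff)
  show "f (int (nat ((int r - c) mod int n))) = f (int r - c)"
    using assms by simp
qed

text \<open>For n > 1, 0 is not coprime to \<open>n\<close>, so coprimality alone forces distinct
  vertices and a nonzero residue \<open>u\<close>. For n = 1 the equivalence fails at a = b =
  0.\<close>

lemma unitary_Cayley_adj_iff:
  assumes "n > 1" "a < n" "b < n"
  shows "unitary_Cayley_adj n a b \<longleftrightarrow> coprime (int a - int b) (int n)"
proof
  assume "unitary_Cayley_adj n a b"
  then obtain u :: int where "gcd u (int n) = 1" "[int a - int b = u] (mod int n)"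
    unfolding unitary_Cayley_adj_def by (elim conjE exE)
  then show "coprime (int a - int b) (int n)"
    by (metis cong_gcd_eq coprime_iff_gcd_eq_1)
next
  assume co: "coprime (int a - int b) (int n)"
  define u where "u = (int a - int b) mod int n"
  have gcd: "gcd u (int n) = 1"
    using co by (simp add: u_def coprime_iff_gcd_eq_1 gcd.commute flip: gcd_red_int)
  have "u \<noteq> 0" using gcd assms(1) by auto
  moreover have "0 \<le> u" "u < int n" using assms(1) by (simp_all add: u_def)
  moreover have "[int a - int b = u] (mod int n)" by (simp add: u_def cong_def)
  moreover have "a \<noteq> b" using co assms(1) by auto
  ultimately show "unitary_Cayley_adj n a b"
    using gcd assms unfolding unitary_Cayley_adj_def
    by (intro conjI exI[of _ u]) auto
qed

text \<open>The conjugate character \<open>rou n (j * (a - r))\<close> turns up in the convolution, whence the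
  argument \<open>- j\<close> of the Ramanujan sum.\<close>

lemma unitary_Cayley_eigenvector:
  assumes "n > 1" "b < n"
  shows "(\<Sum>r<n. rou n (j * (a - int r)) * (if unitary_Cayley_adj n r b then 1 else 0))
       = ramanujan_sum n (- j) * rou n (j * (a - int b))"
proof -
  \<comment> \<open>Writing a - r = (a - b) - (r - b) leaves a constant factor times a periodic
    function of r - b, whose sum over a full period does not depend on \<open>b\<close>.\<close>
  define f where "f x = rou n (x * - j) * (if coprime x (int n) then 1 else 0)" for x
  have per: "f (x mod int n) = f x" for x
  proof -
    have "rou n (x mod int n * - j) = rou n (x * - j)"
      using assms(1) by (intro rou_cong cong_scalar_right) (simp_all add: cong_def)
    moreover have "coprime (x mod int n) (int n) \<longleftrightarrow> coprime x (int n)"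
      using assms(1) by simp
    ultimately show ?thesis by (simp only: f_def)
  qed
  have "(\<Sum>r<n. rou n (j * (a - int r)) * (if unitary_Cayley_adj n r b then 1 else 0))
      = (\<Sum>r<n. rou n (j * (a - int b)) * f (int r - int b))"
  proof (intro sum.cong refl)
    fix r assume "r \<in> {..<n}"
    moreover have "rou n (j * (a - int r)) = rou n (j * (a - int b)) * rou n ((int r - int b) * - j)"
      by (simp flip: rou_add add: algebra_simps)
    ultimately show "rou n (j * (a - int r)) * (if unitary_Cayley_adj n r b then 1 else 0)
        = rou n (j * (a - int b)) * f (int r - int b)"
      using assms by (simp add: f_def unitary_Cayley_adj_iff)
  qed
  also have "\<dots> = rou n (j * (a - int b)) * (\<Sum>r<n. f (int r))"
    using assms(1) per by (simp add: sum_periodic_shift flip: sum_distrib_left)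
  also have "(\<Sum>r<n. f (int r)) = ramanujan_sum n (- j)"
    unfolding ramanujan_sum_def f_def
    by (intro sum.mono_neutral_cong_right) auto
  finally show ?thesis by (simp add: mult.commute)
qed

lemma mult_mat_entry:
  assumes "X \<in> carrier_mat n n" "Y \<in> carrier_mat n n" "a < n" "b < n"
  shows "(X * Y) $$ (a, b) = (\<Sum>r<n. X $$ (a, r) * Y $$ (r, b))"
  using assms by (simp add: scalar_prod_def lessThan_atLeast0)

text \<open>The spectral formula for powers, obtained without diagonalising: each multiplication on
  the right turns the characters into their eigenvalue multiples. The column \<open>b\<close> varies
  in the induction because the product runs over all columns \<open>r\<close> of the previous
  power.\<close>

lemma unitary_Cayley_power_entry:
  fixes s :: complex
  assumes "n > 1" "a < n" "b < n"
  shows "((s \<cdot>\<^sub>m adjacency_matrix n (unitary_Cayley_adj n)) ^\<^sub>m k) $$ (a, b)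
       = (\<Sum>j<n. (s * ramanujan_sum n (- int j)) ^ k * rou n (int j * (int a - int b))) / of_nat n"
  using assms(3)
proof (induction k arbitrary: b)
  case 0
  \<comment> \<open>The zeroth power is the identity matrix, which is orthogonality of characters
    once divisibility of a - b means a = b.\<close>
  have "int n dvd int a - int b \<longleftrightarrow> a = b"
    using assms(2) 0 by (metis cong_iff_dvd_diff cong_int_iff cong_less_modulus_unique_nat cong_refl)
  then show ?case
    using assms 0 by (simp add: adjacency_matrix_def sum_rou)
next
  case (Suc k)
  let ?A = "adjacency_matrix n (unitary_Cayley_adj n)"
  let ?l = "\<lambda>j. ramanujan_sum n (- int j)"
  let ?e = "\<lambda>r. (if unitary_Cayley_adj n r b then 1 else 0) :: complex"
  have A: "s \<cdot>\<^sub>m ?A \<in> carrier_mat n n" by (simp add: adjacency_matrix_def)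
  then have Ak: "(s \<cdot>\<^sub>m ?A) ^\<^sub>m k \<in> carrier_mat n n" by (simp add: pow_carrier_mat)
  have "((s \<cdot>\<^sub>m ?A) ^\<^sub>m Suc k) $$ (a, b)
      = (\<Sum>r<n. ((s \<cdot>\<^sub>m ?A) ^\<^sub>m k) $$ (a, r) * (s \<cdot>\<^sub>m ?A) $$ (r, b))"
    unfolding pow_mat.simps using Ak A assms(2) Suc.prems by (rule mult_mat_entry)
  also have "\<dots> = (\<Sum>r<n. (\<Sum>j<n. (s * ?l j) ^ k * rou n (int j * (int a - int r))) / of_nat n
                    * (s * ?e r))"
    using Suc by (intro sum.cong) (simp_all add: adjacency_matrix_def)
  also have "\<dots> = (\<Sum>r<n. \<Sum>j<n. (s * ?l j) ^ k * s / of_nat n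
                    * (rou n (int j * (int a - int r)) * ?e r))"
    by (intro sum.cong) (simp_all add: sum_divide_distrib sum_distrib_left sum_distrib_right mult_ac)
  also have "\<dots> = (\<Sum>j<n. (s * ?l j) ^ k * s / of_nat n
                    * (\<Sum>r<n. rou n (int j * (int a - int r)) * ?e r))"
    by (subst sum.swap) (simp only: sum_distrib_left)
  also have "\<dots> = (\<Sum>j<n. (s * ?l j) ^ Suc k * rou n (int j * (int a - int b))) / of_nat n"
    unfolding unitary_Cayley_eigenvector[OF assms(1) Suc.prems] sum_divide_distrib
    by (intro sum.cong) (simp_all add: mult_ac)
  finally show ?case .
qed

text \<open>By the formula for powers, each entry of the exponential series is a finite combination
  of scalar exponential series, one per eigenvalue, and these may be summed termwise.\<close>

lemma unitary_Cayley_transition_entry: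
  assumes "n > 1" "a < n" "b < n"
  shows "transition_matrix n (unitary_Cayley_adj n) t $$ (a, b)
       = (\<Sum>j<n. exp (- \<i> * of_real t * ramanujan_sum n (- int j)) * rou n (int j * (int a - int b)))
         / of_nat n"
proof -
  define s where "s = - \<i> * complex_of_real t"
  let ?A = "adjacency_matrix n (unitary_Cayley_adj n)"
  let ?l = "\<lambda>j. ramanujan_sum n (- int j)"
  have "(\<lambda>k. ((s * ?l j) ^ k /\<^sub>R fact k) * rou n (int j * (int a - int b)))
      sums (exp (s * ?l j) * rou n (int j * (int a - int b)))" for j
    by (intro sums_mult2 exp_converges)
  then have "(\<lambda>k. (\<Sum>j<n. ((s * ?l j) ^ k /\<^sub>R fact k) * rou n (int j * (int a - int b))) / of_nat n)
      sums ((\<Sum>j<n. exp (s * ?l j) * rou n (int j * (int a - int b))) / of_nat n)"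
    by (intro sums_divide sums_sum)
  moreover have "(\<Sum>j<n. ((s * ?l j) ^ k /\<^sub>R fact k) * rou n (int j * (int a - int b))) / of_nat n
      = ((s \<cdot>\<^sub>m ?A) ^\<^sub>m k) $$ (a, b) / fact k" for k
    unfolding unitary_Cayley_power_entry[OF assms]
    by (simp add: sum_divide_distrib scaleR_conv_of_real field_simps)
  ultimately have "(\<Sum>k. ((s \<cdot>\<^sub>m ?A) ^\<^sub>m k) $$ (a, b) / fact k)
      = ((\<Sum>j<n. exp (s * ?l j) * rou n (int j * (int a - int b))) / of_nat n)"
    by (simp add: sums_iff)
  moreover have "dim_row (s \<cdot>\<^sub>m ?A) = n" by (simp add: adjacency_matrix_def)
  ultimately show ?thesis
    using assms(2,3) unfolding transition_matrix_def mat_exp_def s_def[symmetric] by simp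
qed

text \<open>Integrality of the eigenvalues enters here: a time shift of 2 pi m multiplies each
  exponential by exp(-2 pi i m l) = 1.\<close>

lemma unitary_Cayley_transition_periodic:
  assumes "n > 1" "a < n" "b < n"
  shows "transition_matrix n (unitary_Cayley_adj n) (t + 2 * pi * of_int m) $$ (a, b)
       = transition_matrix n (unitary_Cayley_adj n) t $$ (a, b)"
proof -
  have "exp (- \<i> * of_real (t + 2 * pi * of_int m) * ramanujan_sum n (- int j))
      = exp (- \<i> * of_real t * ramanujan_sum n (- int j))" for j
  proof -
    obtain l :: int where l: "ramanujan_sum n (- int j) = of_int l"
      using ramanujan_sum_Ints[of n "- int j"] assms(1) by (auto elim: Ints_cases)
    have "- \<i> * of_real (t + 2 * pi * of_int m) * of_int l
        = - \<i> * of_real t * of_int l + \<i> * of_real (2 * pi * of_int (- (m * l)))"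
      by (simp add: algebra_simps)
    moreover have "cis (2 * pi * of_int (- (m * l))) = 1"
      by (rule cis_multiple_2pi) (rule Ints_of_int)
    ultimately show ?thesis
      unfolding l by (simp only: exp_add mult_1_right flip: cis_conv_exp)
  qed
  then show ?thesis
    unfolding unitary_Cayley_transition_entry[OF assms] by (simp only:)
qed

lemma unitary_Cayley_transition_tendsto:
  assumes "n > 1" "a < n" "b < n" "t \<longlonglongrightarrow> s"
  shows "(\<lambda>k. transition_matrix n (unitary_Cayley_adj n) (t k) $$ (a, b))
       \<longlonglongrightarrow> transition_matrix n (unitary_Cayley_adj n) s $$ (a, b)"
  unfolding unitary_Cayley_transition_entry[OF assms(1-3)]
  using assms(1) by (intro tendsto_intros assms(4)) simp

section \<open>Revival\<close>

lemma transition_matrix_carrier: "transition_matrix n E t \<in> carrier_mat n n"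
  by (simp add: transition_matrix_def mat_exp_def adjacency_matrix_def)

lemma transition_mult_unit_vec:
  assumes "a < n" "i < n"
  shows "(transition_matrix n E t *\<^sub>v unit_vec n a) $ i = transition_matrix n E t $$ (i, a)"
  using assms transition_matrix_carrier[of n E t]
  by (simp add: scalar_prod_right_unit)

text \<open>A constant sequence of times suffices, for any graph.\<close>

lemma FR_imp_PGFR:
  assumes "FR_from_to n E a b"
  shows "PGFR_from_to n E a b"
proof -
  from assms obtain t \<alpha> \<beta> where ab: "a < n" "b < n" "a \<noteq> b"
    and coeffs: "\<beta> \<noteq> 0" "(cmod \<alpha>)\<^sup>2 + (cmod \<beta>)\<^sup>2 = 1"
    and rev: "transition_matrix n E t *\<^sub>v unit_vec n a = \<alpha> \<cdot>\<^sub>v unit_vec n a + \<beta> \<cdot>\<^sub>v unit_vec n b"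
    unfolding FR_from_to_def by blast
  have "vec_tendsto n (\<lambda>k. transition_matrix n E t *\<^sub>v unit_vec n a)
      (\<alpha> \<cdot>\<^sub>v unit_vec n a + \<beta> \<cdot>\<^sub>v unit_vec n b)"
    unfolding vec_tendsto_def rev by simp
  then show ?thesis
    unfolding PGFR_from_to_def
    by (intro conjI ab exI[of _ "\<lambda>_. t"] exI[of _ \<alpha>] exI[of _ \<beta>] coeffs)
qed

lemma unitary_Cayley_PGFR_imp_FR:
  assumes "PGFR_from_to n (unitary_Cayley_adj n) a b"
  shows "FR_from_to n (unitary_Cayley_adj n) a b"
proof -
  let ?H = "transition_matrix n (unitary_Cayley_adj n)"
  from assms obtain t \<alpha> \<beta> where ab: "a < n" "b < n" "a \<noteq> b"
    and coeffs: "\<beta> \<noteq> 0" "(cmod \<alpha>)\<^sup>2 + (cmod \<beta>)\<^sup>2 = 1"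
    and lim: "vec_tendsto n (\<lambda>k. ?H (t k) *\<^sub>v unit_vec n a) (\<alpha> \<cdot>\<^sub>v unit_vec n a + \<beta> \<cdot>\<^sub>v unit_vec n b)"
    unfolding PGFR_from_to_def by blast
  \<comment> \<open>Two distinct vertices exist, so the spectral formulas apply.\<close>
  have n: "n > 1" using ab by linarith
  \<comment> \<open>The shift moves \<open>t k\<close> to 2 pi (1 + frac (t k / (2 pi))). The extra
    period keeps the times away from 0, so that their limit point \<open>u\<close> is positive, as
    fractional revival demands.\<close>
  define m where "m k = 1 - \<lfloor>t k / (2 * pi)\<rfloor>" for k
  define s where "s k = t k + 2 * pi * of_int (m k)" for k
  have "s k \<in> {2 * pi..4 * pi}" for k
  proof -
    have "s k = 2 * pi * (1 + frac (t k / (2 * pi)))"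
      by (simp add: s_def m_def frac_def field_simps)
    moreover have "0 \<le> frac (t k / (2 * pi))" "frac (t k / (2 * pi)) \<le> 1"
      using frac_lt_1 less_imp_le by auto
    ultimately show ?thesis by (simp add: field_simps)
  qed
  moreover have "seq_compact {2 * pi..4 * pi}"
    by (intro compact_imp_seq_compact compact_Icc)
  ultimately obtain u and r :: "nat \<Rightarrow> nat" where u: "u \<in> {2 * pi..4 * pi}" "strict_mono r" "(s \<circ> r) \<longlonglongrightarrow> u"
    unfolding seq_compact_def by blast
  \<comment> \<open>Along the subsequence each coordinate tends to the prescribed one and, by
    continuity, to that of column \<open>a\<close> at time \<open>u\<close>. Hence the same \<alpha>
    and \<beta> work.\<close>
  have "?H u *\<^sub>v unit_vec n a = \<alpha> \<cdot>\<^sub>v unit_vec n a + \<beta> \<cdot>\<^sub>v unit_vec n b"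
  proof (rule eq_vecI)
    fix i assume "i < dim_vec (\<alpha> \<cdot>\<^sub>v unit_vec n a + \<beta> \<cdot>\<^sub>v unit_vec n b)"
    then have i: "i < n" by simp
    have "(\<lambda>k. (?H (t k) *\<^sub>v unit_vec n a) $ i)
        \<longlonglongrightarrow> (\<alpha> \<cdot>\<^sub>v unit_vec n a + \<beta> \<cdot>\<^sub>v unit_vec n b) $ i"
      using lim i by (simp only: vec_tendsto_def)
    moreover have "(?H (t k) *\<^sub>v unit_vec n a) $ i = ?H (s k) $$ (i, a)" for k
      unfolding s_def transition_mult_unit_vec[OF ab(1) i]
        unitary_Cayley_transition_periodic[OF n i ab(1)] ..
    ultimately have "(\<lambda>k. ?H (s k) $$ (i, a))
        \<longlonglongrightarrow> (\<alpha> \<cdot>\<^sub>v unit_vec n a + \<beta> \<cdot>\<^sub>v unit_vec n b) $ i"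
      by (simp only:)
    from LIMSEQ_subseq_LIMSEQ[OF this u(2)]
    have "(\<lambda>k. ?H ((s \<circ> r) k) $$ (i, a)) \<longlonglongrightarrow> (\<alpha> \<cdot>\<^sub>v unit_vec n a + \<beta> \<cdot>\<^sub>v unit_vec n b) $ i"
      by (simp only: o_def)
    then have "?H u $$ (i, a) = (\<alpha> \<cdot>\<^sub>v unit_vec n a + \<beta> \<cdot>\<^sub>v unit_vec n b) $ i"
      using unitary_Cayley_transition_tendsto[OF n i ab(1) u(3)] LIMSEQ_unique by blast
    then show "(?H u *\<^sub>v unit_vec n a) $ i = (\<alpha> \<cdot>\<^sub>v unit_vec n a + \<beta> \<cdot>\<^sub>v unit_vec n b) $ i"
      using transition_mult_unit_vec[OF ab(1) i] by simp
  qed (use transition_matrix_carrier[of n "unitary_Cayley_adj n" u] in auto)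
  moreover have "u > 0" using u(1) pi_gt_zero by (auto intro: less_le_trans[of 0 "2 * pi"])
  ultimately show ?thesis
    unfolding FR_from_to_def using ab coeffs by blast
qed

theorem theorem3p10:
  fixes n :: nat
  assumes "n > 0"
  shows "admits_FR n (unitary_Cayley_adj n) \<longleftrightarrow> admits_PGFR n (unitary_Cayley_adj n)"
  unfolding admits_FR_def admits_PGFR_def
  using FR_imp_PGFR unitary_Cayley_PGFR_imp_FR by blast

end
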